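(* The mapping $f$ (counting, for a binary path $P$, the chains with small intervals and minimum length from $P$ to $\mathbf{1}_{|P|}$) satisfies the following properties: (i) $f(P_1P_2)=f(P_1)\,f(dP_2)$, where $P_1$ is a Dyck suffix and $P_2$ is a Dyck prefix (juxtaposition denotes concatenation). (ii) $f(dP)=f(P)$, where $P$ is a Dyck prefix that has at least one return point.
   Context: A (binary) path of length $|P|=n\ge 0$ is a word $P=p_1\cdots p_n$ in the letters $u$ (upstep $(1,1)$) and $d$ (downstep $(1,-1)$), viewed as a lattice path starting at the origin $(0,0)$; $\varepsilon$ is the empty path. $\mathcal{P}_n$ is the set of paths of length $n$. The height of a point is its $y$-coordinate, and $h_i(P)$ is the height of the $i$-th point (after $i$ steps). $\mathcal{P}_n$ is partially ordered by $P\le Q$ iff $h_i(P)\le h_i(Q)$ for all $1\le i\le n$; this is a finite distributive lattice with maximum $\mathbf{1}_n=u^n$. A valley of $P$ is the last point of a maximal run of consecutive $d$'s: it is either the middle point of an occurrence of $du$, or the final point of $P$ if $P$ ends with $d$. Turning a valley into a peak means replacing the corresponding $du$ by $ud$, or replacing the final $d$ by $u$ if the valley is the final point. $Q$ covers $P$ iff $Q$ is obtained from $P$ by turning exactly one valley into a peak. An interval $[x,y]$ in a poset is small if $y$ is the join of some elements covering $x$. A $P-\mathbf{1}_n$ chain $P=P_0<P_1<\cdots<P_k=\mathbf{1}_n$ (of length $k$) in $\mathcal{P}_n$ has small intervals if for every $i\in\{1,\dots,k\}$ the path $P_i$ is obtained by (simultaneously) turning some valleys of $P_{i-1}$ into peaks.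 For $P\in\mathcal{P}_n$, $f(P)$ is the number of $P-\mathbf{1}_n$ chains with small intervals whose length is minimum among all $P-\mathbf{1}_n$ chains with small intervals. A Dyck path is a path that starts and ends at the same height and lies weakly above this height; the empty path is a Dyck path. A Dyck prefix (resp. Dyck suffix) is a path which is a prefix (resp. suffix) of a Dyck path. A return point of a Dyck prefix is a non-initial point of it having height $0$.
   Formalization: In (i) the Dyck suffix P_1 is required to be non-empty: for P_1 = ε the claim would read f(P_2) = f(dP_2), which fails for P_2 = uud, as f(uud) = 1 but f(duud) = 2. *)

theory Defs
  imports Main "HOL-Library.Sublist"
begin

datatype step = U | D

type_synonym path = "step list"

fun rise :: "step \<Rightarrow> int" where
  "rise U = 1"
| "rise D = - 1"

definition height :: "path \<Rightarrow> nat \<Rightarrow> int" where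
  "height P i = sum_list (map rise (take i P))"

definition path_le :: "path \<Rightarrow> path \<Rightarrow> bool" where
  "path_le P Q \<longleftrightarrow>
     length P = length Q \<and> (\<forall>i\<in>{1..length P}. height P i \<le> height Q i)"

definition path_less :: "path \<Rightarrow> path \<Rightarrow> bool" where
  "path_less P Q \<longleftrightarrow> path_le P Q \<and> P \<noteq> Q"

definition top_path :: "nat \<Rightarrow> path" where
  "top_path n = replicate n U"

(* Points are numbered as in height: point i is reached after i steps, so it lies
   between the list entries P ! (i - 1) and P ! i. *)
definition valleys :: "path \<Rightarrow> nat set" where
  "valleys P =
     {i \<in> {1..length P}. P ! (i - 1) = D \<and> (i = length P \<or> P ! i = U)}"

(* For V \<subseteq> valleys P: the step P ! (i - 1) before each valley i in V becomes U, and
   the step P ! i after it, if there is one, becomes D.  The two conditions cannot hold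
   at the same j, since valleys are never adjacent. *)
definition turn_valleys :: "nat set \<Rightarrow> path \<Rightarrow> path" where
  "turn_valleys V P =
     map (\<lambda>j. if Suc j \<in> V then U else if j \<in> V then D else P ! j) [0..<length P]"

definition small_step :: "path \<Rightarrow> path \<Rightarrow> bool" where
  "small_step P Q \<longleftrightarrow> (\<exists>V \<subseteq> valleys P. Q = turn_valleys V P)"

(* The list [P_0, ..., P_k] represents a chain of length k. *)
definition chain_to_top :: "path \<Rightarrow> path list \<Rightarrow> bool" where
  "chain_to_top P cs \<longleftrightarrow>
     cs \<noteq> [] \<and> hd cs = P \<and> last cs = top_path (length P) \<and> successively path_less cs"

definition small_chain :: "path \<Rightarrow> path list \<Rightarrow> bool" where
  "small_chain P cs \<longleftrightarrow> chain_to_top P cs \<and> successively small_step cs"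

definition f :: "path \<Rightarrow> nat" where
  "f P = card {cs. is_arg_min length (small_chain P) cs}"

definition dyck_path :: "path \<Rightarrow> bool" where
  "dyck_path P \<longleftrightarrow> height P (length P) = 0 \<and> (\<forall>i\<le>length P. 0 \<le> height P i)"

definition dyck_prefix :: "path \<Rightarrow> bool" where
  "dyck_prefix P \<longleftrightarrow> (\<exists>Q. dyck_path Q \<and> prefix P Q)"

definition dyck_suffix :: "path \<Rightarrow> bool" where
  "dyck_suffix P \<longleftrightarrow> (\<exists>Q. dyck_path Q \<and> suffix P Q)"

definition return_points :: "path \<Rightarrow> nat set" where
  "return_points P = {i \<in> {1..length P}. height P i = 0}"

end

theory Submission
  imports Defs "HOL-Library.FuncSet"
begin

text \<open>Going from a path \<open>P\<close> of length \<open>n\<close> up to the top path means carrying out tasks (cells):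
  the cell \<open>(i, v)\<close> lifts point \<open>i\<close> from height \<open>v\<close> to \<open>v + 2\<close>, and it can be carried out only in
  a step after both cells \<open>(i - 1, v - 1)\<close> and \<open>(i + 1, v - 1)\<close>, if these are still to be done.
  Hence a chain with small intervals is the same thing as a strictly monotone labelling of
  the cells by step numbers; this is proved by splitting off the first step, which carries out
  an arbitrary set of minimal cells, i.e. turns an arbitrary set of valleys
  (\<open>card_walks_eq_card_schedules\<close>).

  The last cell is \<open>(n, n - 2)\<close>, and from every cell there is a saturated chain of cells to it.
  If steps are numbered so that the last one is \<open>n - 2\<close>, strictness therefore forces the
  label of \<open>(i, v)\<close> to be at most \<open>v\<close>.  If \<open>P\<close> is not the top path, let \<open>b\<close> be
  the least height occurring in a cell.
  The labelling \<open>(i, v) \<mapsto> v\<close> is itself admissible, so a shortest chain starts in step \<open>b\<close>, and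
  \<open>f P\<close> is the number of strict labellings \<open>T\<close> with \<open>b \<le> T (i, v) \<le> v\<close>
  (\<open>f_eq_card_schedules\<close>).  In this form the length of \<open>P\<close> has disappeared.

  If \<open>(a, b)\<close> is a cell of least height \<open>b\<close>, its label is \<open>b\<close>, and then the cells in the cone
  \<open>\<bar>i - a\<bar> \<le> v - b\<close> above it all have the label \<open>v\<close>.  The cone may be deleted: a deleted cell
  bounds the label of a cell below it only by that cell's own deadline
  (\<open>card_schedules_remove_forced\<close>).  Both claims follow by comparing what is left.

  For \<open>P1 P2\<close> the junction is a lowest point, and its cone separates the cells into a left part,
  which is what the cone leaves of the cells of \<open>P1\<close>, and a right part, which is a translate of
  what the cone of the first point leaves of the cells of \<open>d P2\<close>.  No cell of one part is
  adjacent to a cell of the other, so the numbers multiply.  For \<open>d P\<close>, deleting the cone of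
  the first point leaves a translate of the cells of \<open>P\<close> with the starting time \<open>0\<close> in
  the coordinates of \<open>P\<close>; a return point of \<open>P\<close> says exactly that \<open>0\<close> is also the
  starting time of the shortest chains from \<open>P\<close> itself.\<close>

section \<open>Heights and turned valleys\<close>

lemma height_0 [simp]: "height P 0 = 0"
  by (simp add: height_def)

lemma height_Suc: "i < length P \<Longrightarrow> height P (Suc i) = height P i + rise (P ! i)"
  by (simp add: height_def take_Suc_conv_app_nth)

lemma height_append:
  "height (P @ Q) i = height P (min i (length P)) + height Q (i - length P)"
  by (simp add: height_def min_def)

lemma height_Cons: "height (s # P) (Suc i) = rise s + height P i"
  by (simp add: height_def)

lemma height_Suc_cases:
  assumes "i < length P"
  shows "P ! i = U \<and> height P (Suc i) = height P i + 1
       \<or> P ! i = D \<and> height P (Suc i) = height P i - 1"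
  using assms by (cases "P ! i") (simp_all add: height_Suc)

lemma height_bounds:
  assumes "i \<le> length P"
  shows "height P i \<le> int i \<and> - int i \<le> height P i \<and> even (height P i - int i)"
  using assms
proof (induction i)
  case (Suc i)
  then show ?case using height_Suc_cases[of i P] by auto
qed simp

lemma height_dist:
  assumes "i \<le> length P" "j \<le> length P"
  shows "height P i \<le> height P j + \<bar>int i - int j\<bar>"
proof -
  have mono: "\<bar>height P (a + d) - height P a\<bar> \<le> int d" if "a + d \<le> length P" for a d
    using that
  proof (induction d)
    case (Suc d)
    then show ?case using height_Suc_cases[of "a + d" P] by auto
  qed simp
  show ?thesis
    using mono[of i "j - i"] mono[of j "i - j"] assms by (cases "i \<le> j") auto
qed

lemma path_eqI_height:
  assumes len: "length P = length Q" and h: "\<And>i. i \<le> length P \<Longrightarrow> height P i = height Q i"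
  shows "P = Q"
proof (rule nth_equalityI[OF len])
  fix i assume i: "i < length P"
  show "P ! i = Q ! i"
    using height_Suc_cases[OF i] height_Suc_cases[of i Q] h[of i] h[of "Suc i"] i len by auto
qed

lemma length_turn_valleys [simp]: "length (turn_valleys V P) = length P"
  by (simp add: turn_valleys_def)

lemma height_turn_valleys:
  assumes V: "V \<subseteq> valleys P" and "i \<le> length P"
  shows "height (turn_valleys V P) i = height P i + (if i \<in> V then 2 else 0)"
  using \<open>i \<le> length P\<close>
proof (induction i)
  case 0
  then show ?case using V by (auto simp: valleys_def)
next
  case (Suc i)
  have U: "P ! i = U" if "i \<in> V" using that V Suc.prems by (auto simp: valleys_def)
  have D: "P ! i = D" if "Suc i \<in> V" using subsetD[OF V that] by (simp add: valleys_def)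
  have nth: "turn_valleys V P ! i = (if Suc i \<in> V then U else if i \<in> V then D else P ! i)"
    using Suc.prems by (simp add: turn_valleys_def)
  show ?case
    using Suc U D by (auto simp: height_Suc nth)
qed

lemma turn_valleys_inj: "inj_on (\<lambda>V. turn_valleys V P) (Pow (valleys P))"
proof (rule inj_onI)
  fix V W
  assume V: "V \<in> Pow (valleys P)" and W: "W \<in> Pow (valleys P)"
    and eq: "turn_valleys V P = turn_valleys W P"
  have bound: "i \<le> length P" if "i \<in> V \<union> W" for i
    using that V W by (auto simp: valleys_def)
  have "i \<in> V \<longleftrightarrow> i \<in> W" if "i \<le> length P" for i
    using height_turn_valleys[of V P i] height_turn_valleys[of W P i] V W eq that
    by (auto split: if_splits)
  with bound show "V = W" by blast
qed

lemma turn_valleys_empty: "turn_valleys {} P = P"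
  by (simp add: turn_valleys_def map_nth)

lemma small_step_refl: "small_step P P"
  unfolding small_step_def using turn_valleys_empty[of P] by (metis empty_subsetI)

lemma small_step_path_le: "small_step P Q \<Longrightarrow> path_le P Q"
  unfolding small_step_def path_le_def by (auto simp: height_turn_valleys)

lemma length_top_path [simp]: "length (top_path n) = n"
  by (simp add: top_path_def)

lemma height_top_path: "i \<le> n \<Longrightarrow> height (top_path n) i = int i"
  by (simp add: height_def top_path_def min_def sum_list_replicate)

section \<open>Cells and schedules\<close>

type_synonym cell = "int \<times> int"

text \<open>The cell \<open>(i, v)\<close> is the task of lifting point \<open>i\<close> from height \<open>v\<close> to \<open>v + 2\<close>; these are
  the tasks still to be done on the way from \<open>P\<close> to the top path, whose \<open>i\<close>-th point has
  height \<open>i\<close>.  The parity condition selects the heights that point \<open>i\<close> can have.\<close>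

definition cells :: "path \<Rightarrow> cell set" where
  "cells P = {(i, v). 1 \<le> i \<and> i \<le> int (length P) \<and> height P (nat i) \<le> v \<and> v < i \<and> even (v - i)}"

text \<open>Point \<open>i\<close> is a valley at height \<open>v\<close> only once its neighbours have left height \<open>v - 1\<close>.\<close>

definition cell_before :: "cell \<Rightarrow> cell \<Rightarrow> bool" where
  "cell_before c c' \<longleftrightarrow> snd c' = snd c + 1 \<and> \<bar>fst c' - fst c\<bar> = 1"

text \<open>The common lower bound is the starting time; the upper bound is a
  deadline that depends on the cell.\<close>

definition schedules :: "(cell \<Rightarrow> int) \<Rightarrow> int \<Rightarrow> cell set \<Rightarrow> (cell \<Rightarrow> int) set" where
  "schedules w b C =
     {T \<in> (\<Pi>\<^sub>E c\<in>C. {b..w c}). \<forall>c\<in>C. \<forall>c'\<in>C. cell_before c c' \<longrightarrow> T c < T c'}"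

definition initial_cells :: "cell set \<Rightarrow> cell set" where
  "initial_cells C = {c \<in> C. \<forall>c'\<in>C. \<not> cell_before c' c}"

lemma schedulesI:
  assumes "\<And>c. c \<in> C \<Longrightarrow> b \<le> T c" "\<And>c. c \<in> C \<Longrightarrow> T c \<le> w c" "\<And>c. c \<notin> C \<Longrightarrow> T c = undefined"
    "\<And>c c'. c \<in> C \<Longrightarrow> c' \<in> C \<Longrightarrow> cell_before c c' \<Longrightarrow> T c < T c'"
  shows "T \<in> schedules w b C"
  using assms by (auto simp: schedules_def PiE_def extensional_def)

lemma schedulesD:
  assumes "T \<in> schedules w b C"
  shows "c \<in> C \<Longrightarrow> b \<le> T c" "c \<in> C \<Longrightarrow> T c \<le> w c" "c \<notin> C \<Longrightarrow> T c = undefined"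
    "c \<in> C \<Longrightarrow> c' \<in> C \<Longrightarrow> cell_before c c' \<Longrightarrow> T c < T c'"
  using assms by (auto simp: schedules_def PiE_def extensional_def Pi_def simp del: split_paired_All)

lemma finite_schedules: "finite C \<Longrightarrow> finite (schedules w b C)"
  unfolding schedules_def
  by (rule finite_subset[of _ "\<Pi>\<^sub>E c\<in>C. {b..w c}"]) (auto intro: finite_PiE)

lemma finite_cells [simp]: "finite (cells P)"
proof (rule finite_subset)
  show "cells P \<subseteq> {1..int (length P)} \<times> {- int (length P)..int (length P)}"
  proof
    fix c assume "c \<in> cells P"
    then obtain i v where "c = (i, v)" "1 \<le> i" "i \<le> int (length P)" "height P (nat i) \<le> v" "v < i"
      by (auto simp: cells_def)
    then show "c \<in> {1..int (length P)} \<times> {- int (length P)..int (length P)}"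
      using height_bounds[of "nat i" P] by (simp add: nat_le_iff)
  qed
qed simp

text \<open>The cells labelled with the starting time \<open>b\<close> form a set \<open>M\<close> of initial cells, and any such set
  can occur, because the remaining labels exceed \<open>b\<close>.  With a deadline common to all cells,
  the only condition on \<open>M\<close> is that its members are initial.\<close>

lemma card_schedules_first_step:
  assumes fin: "finite C" and bu: "b \<le> u"
  shows "card (schedules (\<lambda>_. u) b C)
       = (\<Sum>M\<in>Pow (initial_cells C). card (schedules (\<lambda>_. u) (b + 1) (C - M)))"
proof -
  let ?w = "\<lambda>_::cell. u"
  let ?first = "\<lambda>T. {c\<in>C. T c = b}"
  let ?S = "\<lambda>M. {T \<in> schedules ?w b C. ?first T = M}"
  have finI: "finite (initial_cells C)" using fin by (simp add: initial_cells_def)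
  have sub: "?first T \<subseteq> initial_cells C" if "T \<in> schedules ?w b C" for T
  proof
    fix c assume c: "c \<in> ?first T"
    have "\<not> cell_before c' c" if "c' \<in> C" for c'
      using schedulesD(1)[OF \<open>T \<in> schedules ?w b C\<close> that]
        schedulesD(4)[OF \<open>T \<in> schedules ?w b C\<close> that, of c] c by auto
    with c show "c \<in> initial_cells C" by (simp add: initial_cells_def)
  qed
  have "schedules ?w b C = (\<Union>M\<in>Pow (initial_cells C). ?S M)"
    using sub by blast
  moreover have "card (\<Union>M\<in>Pow (initial_cells C). ?S M) = (\<Sum>M\<in>Pow (initial_cells C). card (?S M))"
    using finI finite_schedules[OF fin] by (intro card_UN_disjoint) auto
  moreover have "card (?S M) = card (schedules ?w (b + 1) (C - M))" if M: "M \<in> Pow (initial_cells C)" for M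
  proof (rule bij_betw_same_card, rule bij_betw_byWitness[where
        f = "\<lambda>T. restrict T (C - M)" and f' = "\<lambda>T c. if c \<in> M then b else T c"])
    let ?ext = "\<lambda>T c. if c \<in> M then b else T c"
    have MC: "M \<subseteq> C" and min: "\<And>c c'. c \<in> C \<Longrightarrow> c' \<in> M \<Longrightarrow> \<not> cell_before c c'"
      using M by (auto simp: initial_cells_def)
    show "\<forall>T\<in>?S M. ?ext (restrict T (C - M)) = T"
      using MC by (auto simp: fun_eq_iff schedulesD(3))
    show "\<forall>T\<in>schedules ?w (b + 1) (C - M). restrict (?ext T) (C - M) = T"
      by (auto simp: fun_eq_iff schedulesD(3))
    show "(\<lambda>T. restrict T (C - M)) ` ?S M \<subseteq> schedules ?w (b + 1) (C - M)"
    proof (rule image_subsetI)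
      fix T assume "T \<in> ?S M"
      then have T: "T \<in> schedules ?w b C" and "M = ?first T" by auto
      then have "T c \<noteq> b" if "c \<in> C - M" for c using that by blast
      then have "b + 1 \<le> T c" if "c \<in> C - M" for c
        using that schedulesD(1)[OF T, of c] by (metis DiffD1 add1_zle_eq order_less_le)
      then show "restrict T (C - M) \<in> schedules ?w (b + 1) (C - M)"
        by (intro schedulesI) (auto dest: schedulesD[OF T])
    qed
    show "?ext ` schedules ?w (b + 1) (C - M) \<subseteq> ?S M"
    proof (rule image_subsetI)
      fix T assume T: "T \<in> schedules ?w (b + 1) (C - M)"
      have lb: "b < T c" if "c \<in> C - M" for c using schedulesD(1)[OF T that] by simp
      have "?ext T \<in> schedules ?w b C"
      proof (rule schedulesI)
        fix c c' assume cc: "c \<in> C" "c' \<in> C" "cell_before c c'"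
        then have "c' \<notin> M" using min by blast
        then show "?ext T c < ?ext T c'" using lb cc schedulesD(4)[OF T, of c c'] by auto
      next
        fix c assume "c \<notin> C"
        then show "?ext T c = undefined" using MC schedulesD(3)[OF T, of c] by auto
      next
        fix c assume "c \<in> C"
        then show "b \<le> ?ext T c" using lb[of c] by auto
      next
        fix c assume "c \<in> C"
        then show "?ext T c \<le> u" using bu schedulesD(2)[OF T, of c] by auto
      qed
      moreover have "?first (?ext T) = M" using lb MC by auto
      ultimately show "?ext T \<in> ?S M" by blast
    qed
  qed
  ultimately show ?thesis by simp
qed

lemma card_schedules_disjoint:
  assumes disj: "A \<inter> B = {}"
    and unrel: "\<And>c c'. c \<in> A \<Longrightarrow> c' \<in> B \<Longrightarrow> \<not> cell_before c c' \<and> \<not> cell_before c' c"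
  shows "card (schedules w b (A \<union> B)) = card (schedules w b A) * card (schedules w b B)"
proof -
  have "card (schedules w b (A \<union> B)) = card (schedules w b A \<times> schedules w b B)"
  proof (rule bij_betw_same_card, rule bij_betw_byWitness[where
        f = "\<lambda>T. (restrict T A, restrict T B)" and f' = "\<lambda>(S, T) c. if c \<in> A then S c else T c"])
    let ?glue = "\<lambda>(S, T) c. if c \<in> A then S c else T c"
    show "\<forall>T\<in>schedules w b (A \<union> B). ?glue (restrict T A, restrict T B) = T"
      by (auto simp: fun_eq_iff schedulesD(3))
    show "\<forall>p\<in>schedules w b A \<times> schedules w b B. (restrict (?glue p) A, restrict (?glue p) B) = p"
      using disj by (auto simp: fun_eq_iff schedulesD(3))
    show "(\<lambda>T. (restrict T A, restrict T B)) ` schedules w b (A \<union> B)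
            \<subseteq> schedules w b A \<times> schedules w b B"
      by (auto intro!: schedulesI dest: schedulesD)
    show "?glue ` (schedules w b A \<times> schedules w b B) \<subseteq> schedules w b (A \<union> B)"
    proof clarify
      fix S T assume S: "S \<in> schedules w b A" and T: "T \<in> schedules w b B"
      show "(\<lambda>c. if c \<in> A then S c else T c) \<in> schedules w b (A \<union> B)"
        using unrel by (intro schedulesI) (auto dest: schedulesD[OF S] schedulesD[OF T])
    qed
  qed
  then show ?thesis by (simp add: card_cartesian_product)
qed

lemma card_schedules_translate:
  "card (schedules snd (b + q) ((\<lambda>(i, v). (i + p, v + q)) ` C)) = card (schedules snd b C)"
proof -
  let ?m = "\<lambda>(i, v). (i + p, v + q)" and ?n = "\<lambda>(i, v). (i - p, v - q)"
  let ?up = "\<lambda>T c. if ?n c \<in> C then T (?n c) + q else undefined"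
  let ?down = "\<lambda>T c. if c \<in> C then T (?m c) - q else undefined"
  have mem: "c \<in> ?m ` C \<longleftrightarrow> ?n c \<in> C" for c
    by (cases c) (force simp: image_iff)
  have nm: "?n (?m c) = c" "?m (?n c) = c" for c by (cases c; simp)+
  have bef: "cell_before (?m c) (?m c') \<longleftrightarrow> cell_before c c'"
       "cell_before (?n c) (?n c') \<longleftrightarrow> cell_before c c'" for c c'
    by (cases c; cases c'; simp add: cell_before_def)+
  have snds: "snd (?m c) = snd c + q" "snd (?n c) = snd c - q" for c by (cases c; simp)+
  have "bij_betw ?up (schedules snd b C) (schedules snd (b + q) (?m ` C))"
  proof (rule bij_betw_byWitness[where f' = ?down])
    show "\<forall>T\<in>schedules snd b C. ?down (?up T) = T"
      by (auto simp: fun_eq_iff schedulesD(3))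
    show "\<forall>T\<in>schedules snd (b + q) (?m ` C). ?up (?down T) = T"
    proof
      fix T assume T: "T \<in> schedules snd (b + q) (?m ` C)"
      show "?up (?down T) = T"
        using schedulesD(3)[OF T] by (auto simp: fun_eq_iff mem)
    qed
    show "?up ` schedules snd b C \<subseteq> schedules snd (b + q) (?m ` C)"
    proof (rule image_subsetI)
      fix T assume T: "T \<in> schedules snd b C"
      show "?up T \<in> schedules snd (b + q) (?m ` C)"
      proof (rule schedulesI, unfold mem)
        fix c c' assume "?n c \<in> C" "?n c' \<in> C" "cell_before c c'"
        then show "?up T c < ?up T c'"
          using schedulesD(4)[OF T, of "?n c" "?n c'"] bef(2)[of c c'] by simp
      next
        fix c assume "?n c \<in> C"
        then show "?up T c \<le> snd c" "b + q \<le> ?up T c"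
          using schedulesD(1,2)[OF T, of "?n c"] snds(2)[of c] by simp_all
      qed simp
    qed
    show "?down ` schedules snd (b + q) (?m ` C) \<subseteq> schedules snd b C"
    proof (rule image_subsetI)
      fix T assume T: "T \<in> schedules snd (b + q) (?m ` C)"
      show "?down T \<in> schedules snd b C"
      proof (rule schedulesI)
        fix c c' assume "c \<in> C" "c' \<in> C" "cell_before c c'"
        then show "?down T c < ?down T c'"
          using schedulesD(4)[OF T, of "?m c" "?m c'"] bef(1)[of c c'] by simp
      next
        fix c assume "c \<in> C"
        then show "?down T c \<le> snd c" "b \<le> ?down T c"
          using schedulesD(1,2)[OF T, of "?m c"] snds(1)[of c] by simp_all
      qed simp
    qed
  qed
  then show ?thesis by (simp add: bij_betw_same_card)
qed

text \<open>The last two hypotheses force the labels on \<open>F\<close>: starting from the cells at height \<open>b\<close>,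
  strictness along a chain inside \<open>F\<close> pushes every label up to its deadline.  Conversely, a
  schedule of the rest extends by these labels: a cell \<open>c\<close> outside \<open>F\<close> that precedes a cell
  of \<open>F\<close> has label at most \<open>snd c\<close>, which is less than the height of the later cell.\<close>

lemma card_schedules_remove_forced:
  assumes FC: "F \<subseteq> C"
    and up: "\<And>c c'. c \<in> F \<Longrightarrow> c' \<in> C \<Longrightarrow> cell_before c c' \<Longrightarrow> c' \<in> F"
    and lb: "\<And>c. c \<in> F \<Longrightarrow> b \<le> snd c"
    and grounded: "\<And>c. c \<in> F \<Longrightarrow> b < snd c \<Longrightarrow> \<exists>c'\<in>F. cell_before c' c"
  shows "card (schedules snd b C) = card (schedules snd b (C - F))"
proof (rule bij_betw_same_card, rule bij_betw_byWitness[where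
      f = "\<lambda>T. restrict T (C - F)" and f' = "\<lambda>T c. if c \<in> F then snd c else T c"])
  let ?ext = "\<lambda>T c. if c \<in> F then snd c else T c"
  have forced: "T c = snd c" if T: "T \<in> schedules snd b C" and "c \<in> F" for T c
    using \<open>c \<in> F\<close>
  proof (induction "nat (snd c - b)" arbitrary: c rule: less_induct)
    case less
    have le: "b \<le> T c" "T c \<le> snd c" using schedulesD(1,2)[OF T, of c] less.prems FC by auto
    show ?case
    proof (cases "b < snd c")
      case True
      then obtain c' where c': "c' \<in> F" "cell_before c' c" using grounded less.prems by blast
      have "snd c = snd c' + 1" using c'(2) by (simp add: cell_before_def)
      moreover have "T c' = snd c'"
        using less.hyps[of c'] c'(1) \<open>snd c = snd c' + 1\<close> True by simp
      moreover have "T c' < T c" using schedulesD(4)[OF T] c' less.prems FC by blast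
      ultimately show ?thesis using le by simp
    qed (use le in simp)
  qed
  show "\<forall>T\<in>schedules snd b C. ?ext (restrict T (C - F)) = T"
    using FC by (auto simp: fun_eq_iff schedulesD(3) forced)
  show "\<forall>T\<in>schedules snd b (C - F). restrict (?ext T) (C - F) = T"
    by (auto simp: fun_eq_iff schedulesD(3))
  show "(\<lambda>T. restrict T (C - F)) ` schedules snd b C \<subseteq> schedules snd b (C - F)"
    by (auto intro!: schedulesI dest: schedulesD)
  show "?ext ` schedules snd b (C - F) \<subseteq> schedules snd b C"
  proof (rule image_subsetI)
    fix T assume T: "T \<in> schedules snd b (C - F)"
    show "?ext T \<in> schedules snd b C"
    proof (rule schedulesI)
      fix c c' assume cc: "c \<in> C" "c' \<in> C" "cell_before c c'"
      have "snd c' = snd c + 1" using cc(3) by (simp add: cell_before_def)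
      moreover have "T c \<le> snd c" if "c \<notin> F" using schedulesD(2)[OF T, of c] cc that by simp
      moreover have "c' \<in> F" if "c \<in> F" using up cc that by blast
      ultimately show "?ext T c < ?ext T c'" using cc schedulesD(4)[OF T, of c c'] by auto
    next
      fix c assume "c \<notin> C"
      then show "?ext T c = undefined" using FC schedulesD(3)[OF T, of c] by auto
    next
      fix c assume "c \<in> C"
      then show "b \<le> ?ext T c" "?ext T c \<le> snd c"
        using lb[of c] schedulesD(1,2)[OF T, of c] by auto
    qed
  qed
qed

section \<open>Walks of small steps as schedules\<close>

text \<open>A cell \<open>(i, v)\<close> with \<open>v\<close> above the current height of point \<open>i\<close> is preceded by a cell of point
  \<open>i - 1\<close>; and a cell at the current height fails to be initial exactly if a neighbouring point
  is lower, that is, if point \<open>i\<close> is not a valley.\<close>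

lemma initial_cells_eq_valleys:
  "initial_cells (cells P) = (\<lambda>i. (int i, height P i)) ` valleys P"
proof (intro equalityI subsetI)
  fix c assume c: "c \<in> initial_cells (cells P)"
  obtain i v where iv: "c = (int i, v)"
    using c by (cases c) (metis (no_types, lifting) cells_def initial_cells_def case_prodD
      int_nat_eq mem_Collect_eq order_trans zero_le_one)
  have i: "1 \<le> i" "i \<le> length P" "height P i \<le> v" "v < int i" "even (v - int i)"
    using c unfolding iv by (auto simp: initial_cells_def cells_def)
  have no: "c' \<notin> cells P" if "cell_before c' c" for c'
    using c that by (auto simp: initial_cells_def)
  have hb: "even (height P i - int i)" "- int i \<le> height P i"
    using height_bounds[OF i(2)] by auto
  have pred: "height P (i - 1) > v - 1" if "2 \<le> i"
  proof (rule ccontr)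
    assume "\<not> height P (i - 1) > v - 1"
    then have "(int i - 1, v - 1) \<in> cells P"
      using i that by (auto simp: cells_def nat_diff_distrib)
    then show False using no[of "(int i - 1, v - 1)"] by (simp add: iv cell_before_def)
  qed
  have succ: "height P (i + 1) > v - 1" if "i < length P"
  proof (rule ccontr)
    assume "\<not> height P (i + 1) > v - 1"
    then have "(int i + 1, v - 1) \<in> cells P"
      using i that by (auto simp: cells_def nat_add_distrib)
    then show False using no[of "(int i + 1, v - 1)"] by (simp add: iv cell_before_def)
  qed
  have step: "P ! (i - 1) = U \<and> height P i = height P (i - 1) + 1
            \<or> P ! (i - 1) = D \<and> height P i = height P (i - 1) - 1"
    using height_Suc_cases[of "i - 1" P] i by simp
  have "height P i = v \<and> P ! (i - 1) = D"
  proof (cases "i = 1")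
    case True
    then have "v = - 1" using i(4,5) i(3) hb(2) by presburger
    then show ?thesis using True step i by auto
  next
    case False
    then have p: "2 \<le> i" "v - 1 < height P (i - 1)" using i(1) pred by auto
    have D: "P ! (i - 1) = D" "height P i = height P (i - 1) - 1"
    proof -
      have "height P i \<noteq> height P (i - 1) + 1" using p(2) i(3) i(5) hb(1) by presburger
      then show "P ! (i - 1) = D" "height P i = height P (i - 1) - 1" using step by auto
    qed
    moreover have "height P i = v" using D(2) p(2) i(3,5) hb(1) by presburger
    ultimately show ?thesis by simp
  qed
  moreover have "P ! i = U" if "i < length P"
    using succ[OF that] height_Suc_cases[OF that] calculation by auto
  ultimately show "c \<in> (\<lambda>i. (int i, height P i)) ` valleys P"
    using i unfolding iv valleys_def by force
next
  fix c assume "c \<in> (\<lambda>i. (int i, height P i)) ` valleys P"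
  then obtain i where i: "i \<in> valleys P" and c: "c = (int i, height P i)" by blast
  have v: "1 \<le> i" "i \<le> length P" "P ! (i - 1) = D" "i < length P \<Longrightarrow> P ! i = U"
    using i by (auto simp: valleys_def)
  have p: "height P (i - 1) = height P i + 1"
    using height_Suc_cases[of "i - 1" P] v by simp
  have s: "height P (i + 1) = height P i + 1" if "i < length P"
    using height_Suc_cases[OF that] v that by simp
  have "c \<in> cells P"
    using p v height_bounds[OF order_trans[OF diff_le_self[of i 1] v(2)]] height_bounds[OF v(2)]
    by (simp add: c cells_def)
  moreover have "\<not> cell_before c' c" if "c' \<in> cells P" for c'
  proof
    assume b: "cell_before c' c"
    obtain j w where jw: "c' = (j, w)" by (cases c')
    have "height P (nat j) \<le> height P i - 1" "j \<le> int (length P)" "j = int i - 1 \<or> j = int i + 1"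
      using that b by (auto simp: jw c cells_def cell_before_def)
    then show False using p s v by (auto simp: nat_diff_distrib nat_add_distrib)
  qed
  ultimately show "c \<in> initial_cells (cells P)" by (auto simp: initial_cells_def)
qed

lemma cells_turn_valleys:
  assumes V: "V \<subseteq> valleys P"
  shows "cells (turn_valleys V P) = cells P - (\<lambda>i. (int i, height P i)) ` V"
proof -
  have "(i, v) \<in> cells (turn_valleys V P) \<longleftrightarrow> (i, v) \<in> cells P - (\<lambda>i. (int i, height P i)) ` V"
    for i v
  proof (cases "1 \<le> i \<and> i \<le> int (length P)")
    case True
    define j where "j = nat i"
    have j: "i = int j" "1 \<le> j" "j \<le> length P" using True by (auto simp: j_def)
    have "even (height P j - int j)" using height_bounds[OF j(3)] by simp
    then have "height P j + 2 \<le> v \<longleftrightarrow> height P j \<le> v \<and> v \<noteq> height P j" if "even (v - int j)"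
      using that by presburger
    moreover have "height (turn_valleys V P) j = height P j + (if j \<in> V then 2 else 0)"
      using height_turn_valleys[OF V j(3)] .
    moreover have "(i, v) \<in> (\<lambda>i. (int i, height P i)) ` V \<longleftrightarrow> j \<in> V \<and> v = height P j"
      using j(1) by auto
    ultimately show ?thesis
      using j by (auto simp: cells_def)
  next
    case False
    then show ?thesis by (auto simp: cells_def)
  qed
  then show ?thesis by auto
qed

lemma cells_empty_iff: "cells P = {} \<longleftrightarrow> P = top_path (length P)"
proof
  assume e: "cells P = {}"
  show "P = top_path (length P)"
  proof (rule path_eqI_height)
    fix i assume i: "i \<le> length P"
    show "height P i = height (top_path (length P)) i"
    proof (cases "i = 0")
      case False
      have "(int i, height P i) \<notin> cells P" using e by simp
      then show ?thesis using False i height_bounds[OF i] by (auto simp: cells_def height_top_path)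
    qed simp
  qed simp
next
  assume "P = top_path (length P)"
  then have "height P i = int i" if "i \<le> length P" for i using height_top_path that by metis
  then show "cells P = {}" by (auto simp: cells_def)
qed

text \<open>Unlike the chains, walks may stand still.  This makes the number of
  walks of a given length satisfy a recursion over all sets of valleys, the empty one
  included; shortest walks do not stand still.\<close>

definition walks :: "nat \<Rightarrow> path \<Rightarrow> path list set" where
  "walks k P = {cs. length cs = Suc k \<and> hd cs = P \<and> last cs = top_path (length P)
                    \<and> successively small_step cs}"

lemma walks_0: "walks 0 P = (if P = top_path (length P) then {[P]} else {})"
  by (auto simp: walks_def length_Suc_conv)

lemma walks_Suc: "walks (Suc k) P = (\<Union>V\<in>Pow (valleys P). (#) P ` walks k (turn_valleys V P))"
proof (intro equalityI subsetI)
  fix cs assume "cs \<in> walks (Suc k) P"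
  then obtain Q cs' where cs: "cs = P # Q # cs'" "length cs' = k" "small_step P Q"
    "last (Q # cs') = top_path (length P)" "successively small_step (Q # cs')"
    by (auto simp: walks_def length_Suc_conv)
  then obtain V where V: "V \<subseteq> valleys P" "Q = turn_valleys V P" by (auto simp: small_step_def)
  then have "Q # cs' \<in> walks k (turn_valleys V P)" using cs by (simp add: walks_def)
  then show "cs \<in> (\<Union>V\<in>Pow (valleys P). (#) P ` walks k (turn_valleys V P))"
    using V(1) cs(1) by blast
next
  fix cs assume "cs \<in> (\<Union>V\<in>Pow (valleys P). (#) P ` walks k (turn_valleys V P))"
  then obtain V cs' where V: "V \<subseteq> valleys P" and cs: "cs = P # cs'" "cs' \<in> walks k (turn_valleys V P)"
    by blast
  obtain cs'' where "cs' = turn_valleys V P # cs''"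
    using cs(2) by (cases cs') (auto simp: walks_def)
  then show "cs \<in> walks (Suc k) P"
    using cs V by (auto simp: walks_def small_step_def)
qed

lemma finite_valleys: "finite (valleys P)"
  by (simp add: valleys_def)

lemma finite_walks: "finite (walks k P)"
  by (induction k arbitrary: P) (auto simp: walks_0 walks_Suc finite_valleys)

text \<open>Steps are numbered so that the last one is \<open>n - 2\<close>, the height of the last cell.  Then a walk of
  \<open>k\<close> steps starts in step \<open>n - 1 - k\<close>, and both sides obey the same recursion on the first step.\<close>

lemma card_walks_eq_card_schedules:
  "card (walks k P) = card (schedules (\<lambda>_. int (length P) - 2) (int (length P) - 1 - int k) (cells P))"
proof (induction k arbitrary: P)
  case 0
  show ?case
  proof (cases "cells P = {}")
    case True
    then have "P = top_path (length P)" using cells_empty_iff by blast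
    then have "walks 0 P = {[P]}" by (simp add: walks_0)
    then show ?thesis by (simp add: True schedules_def)
  next
    case False
    then have "P \<noteq> top_path (length P)" using cells_empty_iff by blast
    moreover obtain c where c: "c \<in> cells P" using False by blast
    have "schedules (\<lambda>_. int (length P) - 2) (int (length P) - 1 - int 0) (cells P) = {}"
    proof (rule equals0I)
      fix T assume "T \<in> schedules (\<lambda>_. int (length P) - 2) (int (length P) - 1 - int 0) (cells P)"
      from schedulesD(1,2)[OF this c] show False by simp
    qed
    ultimately show ?thesis by (simp add: walks_0)
  qed
next
  case (Suc k)
  let ?n = "int (length P)" and ?c = "\<lambda>i. (int i, height P i)"
  let ?W = "\<lambda>V. (#) P ` walks k (turn_valleys V P)"
  have "card (walks (Suc k) P) = (\<Sum>V\<in>Pow (valleys P). card (?W V))"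
    unfolding walks_Suc
  proof (rule card_UN_disjoint)
    show "\<forall>V\<in>Pow (valleys P). \<forall>W\<in>Pow (valleys P). V \<noteq> W \<longrightarrow> ?W V \<inter> ?W W = {}"
      using inj_onD[OF turn_valleys_inj] by (fastforce simp: walks_def)
  qed (simp_all add: finite_valleys finite_walks)
  also have "\<dots> = (\<Sum>V\<in>Pow (valleys P).
      card (schedules (\<lambda>_. ?n - 2) (?n - 1 - int k) (cells P - ?c ` V)))"
    by (rule sum.cong) (simp_all add: card_image Suc.IH cells_turn_valleys)
  also have "\<dots> = (\<Sum>M\<in>(`) ?c ` Pow (valleys P).
      card (schedules (\<lambda>_. ?n - 2) (?n - 1 - int k) (cells P - M)))"
    by (subst sum.reindex) (simp_all add: inj_on_image_Pow inj_on_def[of ?c])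
  also have "(`) ?c ` Pow (valleys P) = Pow (initial_cells (cells P))"
    by (simp add: initial_cells_eq_valleys image_Pow_surj)
  also have "(\<Sum>M\<in>Pow (initial_cells (cells P)).
      card (schedules (\<lambda>_. ?n - 2) (?n - 1 - int k) (cells P - M)))
    = card (schedules (\<lambda>_. ?n - 2) (?n - 1 - int (Suc k)) (cells P))"
    by (subst card_schedules_first_step) (simp_all add: algebra_simps)
  finally show ?case .
qed

text \<open>A cell below height \<open>n - 2\<close> precedes a cell that is one unit higher: to its right, or to its left
  if it belongs to the final point.  The bound \<open>n - 2\<close> thus propagates downwards, with a
  loss of one for each unit of height.\<close>

lemma schedule_le_height:
  assumes T: "T \<in> schedules (\<lambda>_. int (length P) - 2) b (cells P)" and c: "c \<in> cells P"
  shows "T c \<le> snd c"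
  using c
proof (induction "nat (int (length P) - 2 - snd c)" arbitrary: c rule: less_induct)
  case less
  obtain i v where iv: "c = (i, v)" by (cases c)
  have i: "1 \<le> i" "i \<le> int (length P)" "height P (nat i) \<le> v" "v < i" "even (v - i)"
    using less.prems by (auto simp: iv cells_def)
  show ?case
  proof (cases "v < int (length P) - 2")
    case False
    then show ?thesis using schedulesD(2)[OF T less.prems] by (simp add: iv)
  next
    case True
    define j where "j = (if i < int (length P) then i + 1 else i - 1)"
    have vi: "v \<noteq> i - 3 \<and> v \<noteq> i - 1" using i(5) by auto
    have j: "1 \<le> j" "j \<le> int (length P)" "v + 1 < j" "even (v + 1 - j)" "\<bar>j - i\<bar> = 1"
      using i True vi height_bounds[of "nat i" P] by (auto simp: j_def)
    have "height P (nat j) \<le> height P (nat i) + \<bar>int (nat j) - int (nat i)\<bar>"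
      by (rule height_dist) (use i j in auto)
    then have "(j, v + 1) \<in> cells P" using i j by (auto simp: cells_def)
    moreover have "cell_before c (j, v + 1)" using j by (simp add: iv cell_before_def)
    ultimately have "T c < T (j, v + 1)" "T (j, v + 1) \<le> v + 1"
      using schedulesD(4)[OF T less.prems] less.hyps[of "(j, v + 1)"] True by (auto simp: iv)
    then show ?thesis by (simp add: iv)
  qed
qed

lemma schedules_uniform_deadline:
  "schedules (\<lambda>_. int (length P) - 2) b (cells P) = schedules snd b (cells P)"
proof (intro equalityI subsetI)
  fix T assume T: "T \<in> schedules (\<lambda>_. int (length P) - 2) b (cells P)"
  show "T \<in> schedules snd b (cells P)"
    by (rule schedulesI) (use schedulesD[OF T] schedule_le_height[OF T] in auto)
next
  fix T assume T: "T \<in> schedules snd b (cells P)"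
  have "snd c \<le> int (length P) - 2" if "c \<in> cells P" for c
  proof (cases c)
    case (Pair i v)
    then have "v < i" "even (v - i)" "i \<le> int (length P)" using that by (auto simp: cells_def)
    then show ?thesis unfolding Pair snd_conv by presburger
  qed
  then show "T \<in> schedules (\<lambda>_. int (length P) - 2) b (cells P)"
    by (intro schedulesI) (use schedulesD[OF T] order_trans in blast)+
qed

text \<open>A walk of minimal length cannot stand still, since removing adjacent repetitions would make
  it shorter.  So it is a chain, and chains are walks.\<close>

lemma f_eq_card_shortest_walks:
  assumes ne: "walks k P \<noteq> {}" and min: "\<And>l. l < k \<Longrightarrow> walks l P = {}"
  shows "f P = card (walks k P)"
proof -
  have walk: "cs \<in> walks (length cs - 1) P" if "small_chain P cs" for cs
    using that by (cases cs) (auto simp: small_chain_def chain_to_top_def walks_def)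
  have long: "Suc k \<le> length cs" if "small_chain P cs" for cs
  proof (rule ccontr)
    assume "\<not> Suc k \<le> length cs"
    moreover have "cs \<noteq> []" using that by (auto simp: small_chain_def chain_to_top_def)
    ultimately have "length cs - 1 < k" by (cases cs) auto
    with min walk[OF that] show False by blast
  qed
  have chain: "small_chain P cs" if "cs \<in> walks k P" for cs
  proof -
    let ?r = "remdups_adj cs"
    have cs: "length cs = Suc k" "hd cs = P" "last cs = top_path (length P)"
      "successively small_step cs" using that by (auto simp: walks_def)
    then have "cs \<noteq> []" by auto
    then have rne: "?r \<noteq> []" by simp
    have "?r \<in> walks (length ?r - 1) P"
      using cs rne \<open>cs \<noteq> []\<close>
      by (auto simp: walks_def successively_remdups_adj_iff small_step_refl Suc_diff_le)
    then have "\<not> length ?r - 1 < k" using min by blast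
    moreover have "0 < length ?r" using rne by simp
    ultimately have "length ?r = length cs"
      using cs(1) remdups_adj_length[of cs] by arith
    then have "distinct_adj cs" by (simp add: distinct_adj_conv_length_remdups_adj)
    then have "successively path_less cs"
      using cs(4) by (auto simp: successively_conv_nth distinct_adj_def path_less_def small_step_path_le)
    then show ?thesis using cs \<open>cs \<noteq> []\<close> by (auto simp: small_chain_def chain_to_top_def)
  qed
  have len: "length cs = Suc k" if "cs \<in> walks k P" for cs using that by (simp add: walks_def)
  have "{cs. is_arg_min length (small_chain P) cs} = walks k P"
  proof (intro equalityI subsetI)
    fix cs assume "cs \<in> {cs. is_arg_min length (small_chain P) cs}"
    then have cs: "small_chain P cs" "\<And>ds. small_chain P ds \<Longrightarrow> \<not> length ds < length cs"
      by (auto simp: is_arg_min_def)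
    obtain ds where "ds \<in> walks k P" using ne by blast
    then have "length cs = Suc k" using cs chain[of ds] len[of ds] long[of cs] by force
    then show "cs \<in> walks k P" using walk[OF cs(1)] by simp
  next
    fix cs assume "cs \<in> walks k P"
    then show "cs \<in> {cs. is_arg_min length (small_chain P) cs}"
      using chain len long by (fastforce simp: is_arg_min_def)
  qed
  then show ?thesis by (simp add: f_def)
qed

text \<open>Labelling every cell with its height is admissible from starting time \<open>b\<close> on, whereas for a later
  starting time the deadline of \<open>c\<close> has already passed.  So \<open>b\<close> corresponds to the minimal length.\<close>

lemma f_eq_card_schedules:
  assumes c: "c \<in> cells P" "snd c = b" and low: "\<And>c. c \<in> cells P \<Longrightarrow> b \<le> snd c"
  shows "f P = card (schedules snd b (cells P))"
proof -
  let ?n = "int (length P)"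
  define k where "k = nat (?n - 1 - b)"
  have "b < ?n" using c by (cases c) (auto simp: cells_def)
  then have k: "?n - 1 - int k = b" by (simp add: k_def)
  have W: "card (walks l P) = card (schedules snd (?n - 1 - int l) (cells P))" for l
    by (simp add: card_walks_eq_card_schedules schedules_uniform_deadline)
  have "restrict snd (cells P) \<in> schedules snd b (cells P)"
    by (rule schedulesI) (use low in \<open>auto simp: cell_before_def\<close>)
  then have "card (schedules snd b (cells P)) \<noteq> 0"
    using finite_schedules[of "cells P"] by auto
  then have "walks k P \<noteq> {}" using W[of k] k by auto
  moreover have "walks l P = {}" if "l < k" for l
  proof -
    have "schedules snd (?n - 1 - int l) (cells P) = {}"
    proof (rule equals0I)
      fix T assume "T \<in> schedules snd (?n - 1 - int l) (cells P)"
      from schedulesD(1,2)[OF this c(1)] show False using c(2) k that by simp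
    qed
    then show ?thesis using W[of l] finite_walks[of l P] by simp
  qed
  ultimately have "f P = card (walks k P)" by (rule f_eq_card_shortest_walks)
  then show ?thesis using W[of k] k by simp
qed

section \<open>The forced cone (int a)bove a lowest point\<close>

text \<open>Among the cells of the right parity, these are the ones that can be reached from \<open>(a, h)\<close> by
  repeatedly going up one unit and one point to the left or to the right.\<close>

definition cone :: "int \<Rightarrow> int \<Rightarrow> cell set" where
  "cone a h = {(i, v). \<bar>i - a\<bar> \<le> v - h}"

text \<open>Every cell of the cone other than its apex has a predecessor in the cone, obtained by moving towards
  point \<open>a\<close> or, straight above the apex, to the left.  This predecessor is a cell of \<open>P\<close> because
  a path cannot leave its lowest point faster than with slope one.\<close>

lemma f_eq_card_schedules_outside_cone:
  assumes a: "1 \<le> a" "a \<le> length P" and ha: "height P a < int a"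
    and low: "\<And>i. 1 \<le> i \<Longrightarrow> i \<le> length P \<Longrightarrow> height P a \<le> height P i"
  shows "f P = card (schedules snd (height P a) (cells P - cone (int a) (height P a)))"
proof -
  let ?h = "height P a"
  let ?F = "cells P \<inter> cone (int a) ?h"
  have pa: "even (?h - int a)" "- int a \<le> ?h" using height_bounds[OF a(2)] by auto
  have "f P = card (schedules snd ?h (cells P))"
  proof (rule f_eq_card_schedules)
    show "(int a, ?h) \<in> cells P" using a ha pa by (auto simp: cells_def)
    fix c assume "c \<in> cells P"
    then show "?h \<le> snd c"
      using low[of "nat (fst c)"] by (cases c) (simp add: cells_def nat_le_iff Suc_le_eq)
  qed simp
  also have "\<dots> = card (schedules snd ?h (cells P - ?F))"
  proof (rule card_schedules_remove_forced)
    fix c c' assume "c \<in> ?F" "c' \<in> cells P" "cell_before c c'"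
    then show "c' \<in> ?F"
      by (cases c; cases c') (auto simp: cone_def cell_before_def)
  next
    fix c assume "c \<in> ?F"
    then show "?h \<le> snd c" by (auto simp: cone_def)
  next
    fix c assume c: "c \<in> ?F" "?h < snd c"
    obtain i v where iv: "c = (i, v)" by (cases c)
    have i: "1 \<le> i" "i \<le> int (length P)" "v < i" "even (v - i)" "\<bar>i - int a\<bar> \<le> v - ?h" "?h < v"
      using c by (auto simp: iv cells_def cone_def)
    define j where "j = (if i < int a then i + 1 else i - 1)"
    \<comment> \<open>Above the apex parity leaves room for the step aside, which would otherwise leave the cone.\<close>
    have tight: "v \<ge> ?h + 2" if "i = int a" using pa i that by presburger
    have "2 \<le> i" if "\<not> i < int a"
      using that i a(1) tight pa(2) by (cases "i = int a") auto
    then have j: "1 \<le> j" "j \<le> int (length P)" "v - 1 < j" "even (v - 1 - j)" "\<bar>i - j\<bar> = 1"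
      using i a by (auto simp: j_def)
    have j_cone: "\<bar>j - int a\<bar> \<le> v - 1 - ?h"
      using i(5) tight by (cases "i = int a") (auto simp: j_def)
    have "height P (nat j) \<le> ?h + \<bar>int (nat j) - int a\<bar>"
      by (rule height_dist) (use j a in auto)
    then have "(j, v - 1) \<in> ?F" using j j_cone by (auto simp: cells_def cone_def)
    moreover have "cell_before (j, v - 1) c" using j by (simp add: iv cell_before_def)
    ultimately show "\<exists>c'\<in>?F. cell_before c' c" by blast
  qed simp
  also have "cells P - ?F = cells P - cone (int a) ?h" by blast
  finally show ?thesis .
qed

lemma dyck_prefix_height_nonneg:
  assumes "dyck_prefix P" "i \<le> length P"
  shows "0 \<le> height P i"
proof -
  obtain Q R where Q: "dyck_path Q" "Q = P @ R"
    using assms(1) by (auto simp: dyck_prefix_def prefix_def)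
  then have "0 \<le> height Q i" using assms(2) by (auto simp: dyck_path_def)
  then show ?thesis using Q(2) assms(2) by (simp add: height_append)
qed

lemma dyck_suffix_end_lowest:
  assumes "dyck_suffix P" "i \<le> length P"
  shows "height P (length P) \<le> height P i"
proof -
  obtain Q R where Q: "dyck_path Q" "Q = R @ P"
    using assms(1) by (auto simp: dyck_suffix_def suffix_def)
  then have "height Q (length R + length P) = 0" "0 \<le> height Q (length R + i)"
    using assms(2) by (auto simp: dyck_path_def)
  then show ?thesis using Q(2) by (simp add: height_append)
qed

lemma f_Cons_D_dyck_prefix:
  assumes P: "dyck_prefix P"
  shows "f (D # P) = card (schedules snd (- 1) (cells (D # P) - cone 1 (- 1)))"
proof -
  have h: "height (D # P) (Suc i) = height P i - 1" for i by (simp add: height_Cons)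
  have "f (D # P) = card (schedules snd (height (D # P) 1)
          (cells (D # P) - cone (int 1) (height (D # P) 1)))"
  proof (rule f_eq_card_schedules_outside_cone)
    fix i assume "1 \<le> i" "i \<le> length (D # P)"
    then show "height (D # P) 1 \<le> height (D # P) i"
      using dyck_prefix_height_nonneg[OF P, of "i - 1"] h[of "i - 1"] h[of 0] by (simp add: le_diff_conv)
  qed (use h[of 0] in simp_all)
  then show ?thesis using h[of 0] by simp
qed

text \<open>The cone of the first point consists of the cells \<open>(i, i - 2)\<close>, the highest one of each point.
  They are exactly the tasks that an initial downstep adds to those of \<open>P\<close>.\<close>

lemma cells_Cons_D_outside_cone:
  "cells (D # P) - cone 1 (- 1) = (\<lambda>(i, v). (i + 1, v - 1)) ` cells P"
proof -
  have h: "height (D # P) (nat i) = height P (nat (i - 1)) - 1" if "2 \<le> i" for i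
    using height_Cons[of D P "nat (i - 1)"] that by (simp add: Suc_nat_eq_nat_zadd1)
  have "(i, v) \<in> cells (D # P) - cone 1 (- 1) \<longleftrightarrow> (i - 1, v + 1) \<in> cells P" for i v
  proof (cases "2 \<le> i")
    case True
    then show ?thesis using h[OF True] by (auto simp: cells_def cone_def)
  next
    case False
    moreover have "height (D # P) (nat i) = - 1" if "i = 1"
      using that height_Cons[of D P 0] by simp
    ultimately show ?thesis by (cases "i = 1") (auto simp: cells_def cone_def)
  qed
  moreover have "(i, v) \<in> (\<lambda>(i, v). (i + 1, v - 1)) ` cells P \<longleftrightarrow> (i - 1, v + 1) \<in> cells P" for i v
    by (force simp: image_iff)
  ultimately show ?thesis by (metis (no_types, lifting) prod.exhaust set_eqI)
qed

text \<open>The cone above the junction \<open>a\<close> contains all cells of point \<open>a\<close>, so the remaining cells of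
  \<open>P1 @ P2\<close> lie strictly to its left or strictly to its right and do not interact.  The right ones
  are a translate of those of \<open>D # P2\<close> outside the cone of its first point, which plays the role
  of the junction.\<close>

lemma f_append:
  assumes ne: "P1 \<noteq> []" and P1: "dyck_suffix P1" and P2: "dyck_prefix P2"
  shows "f (P1 @ P2) = f P1 * f (D # P2)"
proof -
  let ?P = "P1 @ P2"
  define a where "a = length P1"
  define h where "h = height P1 a"
  have a: "1 \<le> a" using ne by (cases P1) (auto simp: a_def)
  have pa: "even (h - int a)" using height_bounds[of a P1] by (simp add: h_def a_def)
  have low: "h \<le> height P1 i" if "i \<le> a" for i
    using dyck_suffix_end_lowest[OF P1] that by (simp add: h_def a_def)
  have h1: "height ?P i = height P1 i" if "i \<le> a" for i
    using that by (simp add: height_append a_def)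
  have h2: "height ?P i = h + height P2 (i - a)" if "a \<le> i" for i
    using that by (simp add: height_append a_def h_def)
  have ha: "h < int a" using low[of "a - 1"] height_bounds[of "a - 1" P1] a by (auto simp: a_def)
  have f1: "f P1 = card (schedules snd h (cells P1 - cone (int a) h))"
    using f_eq_card_schedules_outside_cone[of a P1] a ha low by (simp add: h_def a_def)
  have f12: "f ?P = card (schedules snd h (cells ?P - cone (int a) h))"
  proof -
    have "h \<le> height ?P i" if "1 \<le> i" "i \<le> length ?P" for i
      using that low h1 h2 dyck_prefix_height_nonneg[OF P2, of "i - a"]
      by (cases "i \<le> a") (auto simp: a_def)
    then show ?thesis
      using f_eq_card_schedules_outside_cone[of a ?P] a ha h1[of a] by (simp add: h_def a_def)
  qed
  \<comment> \<open>The translation takes the first point \<open>(1, -1)\<close> of \<open>D # P2\<close> to the junction \<open>(a, h)\<close>.\<close>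
  define R where "R = (\<lambda>(i, v). (i + (int a - 1), v + (h + 1))) ` (cells (D # P2) - cone 1 (- 1))"
  have R: "(i, v) \<in> R \<longleftrightarrow> int a < i \<and> (i, v) \<in> cells ?P - cone (int a) h" for i v
  proof -
    have "(i, v) \<in> R \<longleftrightarrow> (i - int a, v - h) \<in> cells P2"
      unfolding R_def cells_Cons_D_outside_cone by (force simp: image_iff)
    also have "\<dots> \<longleftrightarrow> int a < i \<and> (i, v) \<in> cells ?P - cone (int a) h"
    proof (cases "int a < i")
      case True
      then have "height ?P (nat i) = h + height P2 (nat (i - int a))"
        using h2[of "nat i"] by (simp add: nat_diff_distrib)
      moreover have "even (v - h - (i - int a)) \<longleftrightarrow> even (v - i)" using pa by presburger
      ultimately show ?thesis using True ha a by (auto simp: cells_def cone_def a_def)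
    qed (auto simp: cells_def)
    finally show ?thesis .
  qed
  have L: "(i, v) \<in> cells P1 - cone (int a) h \<longleftrightarrow> i < int a \<and> (i, v) \<in> cells ?P - cone (int a) h" for i v
  proof (cases "1 \<le> i \<and> i < int a")
    case True
    then show ?thesis using h1[of "nat i"] by (simp add: cells_def cone_def a_def nat_le_iff)
  qed (auto simp: cells_def cone_def a_def h_def)
  have off_axis: "i \<noteq> int a" if "(i, v) \<in> cells ?P - cone (int a) h" for i v
    using that h1[of a] by (auto simp: cells_def cone_def h_def)
  have split: "cells ?P - cone (int a) h = (cells P1 - cone (int a) h) \<union> R"
    using L R off_axis by (force simp: set_eq_iff)
  have left: "fst c < int a" if "c \<in> cells P1 - cone (int a) h" for c
    using that L[of "fst c" "snd c"] by simp
  have right: "int a < fst c" if "c \<in> R" for c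
    using that R[of "fst c" "snd c"] by simp
  have "f ?P = card (schedules snd h (cells P1 - cone (int a) h)) * card (schedules snd h R)"
    unfolding f12 split
  proof (rule card_schedules_disjoint)
    show "(cells P1 - cone (int a) h) \<inter> R = {}" using left right by fastforce
  next
    fix c c' assume "c \<in> cells P1 - cone (int a) h" "c' \<in> R"
    then have "fst c < int a" "int a < fst c'" using left right by blast+
    then show "\<not> cell_before c c' \<and> \<not> cell_before c' c"
      by (auto simp: cell_before_def)
  qed
  also have "card (schedules snd h R) = f (D # P2)"
    using card_schedules_translate[of "- 1" "h + 1" "int a - 1"] 
    by (simp add: R_def f_Cons_D_dyck_prefix[OF P2])
  finally show ?thesis by (simp add: f1)
qed

text \<open>Deleting the cone of the first point of \<open>D # P\<close> gives the cells of \<open>P\<close>, with the starting time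
  \<open>-1\<close> translated to \<open>0\<close>.  The return point provides a cell of \<open>P\<close> at height \<open>0\<close>, hence the same
  starting time for \<open>P\<close>.\<close>

lemma f_Cons_D:
  assumes P: "dyck_prefix P" and ret: "return_points P \<noteq> {}"
  shows "f (D # P) = f P"
proof -
  obtain a where a: "1 \<le> a" "a \<le> length P" "height P a = 0"
    using ret by (auto simp: return_points_def)
  have "f P = card (schedules snd 0 (cells P))"
  proof (rule f_eq_card_schedules)
    show "(int a, 0) \<in> cells P" using a height_bounds[OF a(2)] by (auto simp: cells_def)
    fix c assume "c \<in> cells P"
    then show "0 \<le> snd c"
      using dyck_prefix_height_nonneg[OF P, of "nat (fst c)"]
      by (cases c) (simp add: cells_def nat_le_iff)
  qed simp
  then show ?thesis
    using card_schedules_translate[of 0 "- 1" 1 "cells P"]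
    by (simp add: f_Cons_D_dyck_prefix[OF P] cells_Cons_D_outside_cone)
qed

theorem proposition1:
  shows "(\<forall>P1 P2. P1 \<noteq> [] \<and> dyck_suffix P1 \<and> dyck_prefix P2 \<longrightarrow>
            f (P1 @ P2) = f P1 * f (D # P2)) \<and>
         (\<forall>P. dyck_prefix P \<and> return_points P \<noteq> {} \<longrightarrow> f (D # P) = f P)"
  using f_append f_Cons_D by blast

end
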